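(* Let $p>0$. The operators $T_n$, $n\ge1$, are uniformly bounded in the Orlicz space $\exp L_p$ if and only if $p\le1$.
   Context: For an increasing convex function $M$ on $[0,\infty)$ with $M(0)=0$, the Orlicz space $L_M$ on $[0,1]$ has norm $\|x\|_{L_M}=\inf\{\lambda>0:\int_0^1M(|x(t)|/\lambda)\,dt\le1\}$. For $p>0$ let $M_p(u)=e^{u^p}-1$; it is convex for $p\ge1$ and is equivalent to a convex function for $0<p<1$ (in which case it is replaced by that convex function). The space $L_{M_p}$ is denoted $\exp L_p$. Operators $T_n$. Let $S_n$ be the set of permutations of $\{1,\dots,n\}$, identified (in an arbitrary fixed way) with $\{1,\dots,n!\}$. Define $A_n:\mathbb{R}^n\to\mathbb{R}^{n!}$ by $A_nx(\pi)=\sum_{i:\pi(i)=i}x_i$, $\pi\in S_n$; define $B_n:L_1[0,1]\to\mathbb{R}^n$ by $(B_nx)_i=n\int_{(i-1)/n}^{i/n}x(t)\,dt$; define $C_n$ on $\mathbb{R}^n$ by $C_nx=\sum_{k=1}^nx_k\chi_{(\frac{k-1}n,\frac kn)}$. Then $T_n=C_{n!}A_nB_n$. Uniform boundedness in $E$ means $\sup_n\|T_n\|_{E\to E}<\infty$. *)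

theory Defs
  imports "HOL-Analysis.Analysis" "HOL-Combinatorics.Permutations"
begin

definition orlicz_function :: "(real \<Rightarrow> real) \<Rightarrow> bool" where
  "orlicz_function M \<longleftrightarrow> mono_on {0..} M \<and> convex_on {0..} M \<and> M 0 = 0"

(* The Luxemburg norm, defined on all functions with value infinity outside L_M
   (the infimum of the empty set in ennreal is infinity).
   Functions are not identified almost everywhere, so this is a seminorm. *)
definition orlicz_norm :: "(real \<Rightarrow> real) \<Rightarrow> (real \<Rightarrow> real) \<Rightarrow> ennreal" where
  "orlicz_norm M x =
     Inf {ennreal r | r. r > 0 \<and>
       (\<integral>\<^sup>+ t. ennreal (M (\<bar>x t\<bar> / r)) \<partial>lebesgue_on {0..1}) \<le> 1}"

definition orlicz_space :: "(real \<Rightarrow> real) \<Rightarrow> (real \<Rightarrow> real) set" where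
  "orlicz_space M = {x \<in> borel_measurable (lebesgue_on {0..1}). orlicz_norm M x < \<infinity>}"

definition orlicz_opnorm :: "(real \<Rightarrow> real) \<Rightarrow> ((real \<Rightarrow> real) \<Rightarrow> real \<Rightarrow> real) \<Rightarrow> ennreal" where
  "orlicz_opnorm M T = (SUP x \<in> {x \<in> orlicz_space M. orlicz_norm M x \<le> 1}. orlicz_norm M (T x))"

(* Equivalence at infinity, the relation that determines Orlicz spaces (up to an equivalent
   norm) over a finite measure space. Equivalence near 0 is not demanded: for p < 1
   the function exp (u powr p) - 1 is not equivalent to any convex function there. *)
definition orlicz_equivalent :: "(real \<Rightarrow> real) \<Rightarrow> (real \<Rightarrow> real) \<Rightarrow> bool" where
  "orlicz_equivalent M N \<longleftrightarrow>
     (\<exists>a>0. \<exists>b>0. \<exists>u0\<ge>0. \<forall>u\<ge>u0. M (a * u) \<le> N u \<and> N u \<le> M (b * u))"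

definition exp_fun :: "real \<Rightarrow> real \<Rightarrow> real" where
  "exp_fun p u = exp (u powr p) - 1"

(* N is an admissible choice of the convex function defining exp L_p: exp_fun p itself
   if p >= 1, any equivalent convex function if 0 < p < 1. *)
definition exp_orlicz_function :: "real \<Rightarrow> (real \<Rightarrow> real) \<Rightarrow> bool" where
  "exp_orlicz_function p N \<longleftrightarrow>
     (if p \<ge> 1 then N = exp_fun p
      else orlicz_function N \<and> orlicz_equivalent (exp_fun p) N)"

(* Vectors in R^n are functions on nat, of which only the values on {1..n} matter. *)

definition A_op :: "nat \<Rightarrow> (nat \<Rightarrow> real) \<Rightarrow> (nat \<Rightarrow> nat) \<Rightarrow> real" where
  "A_op n x \<pi> = (\<Sum>i\<in>{i\<in>{1..n}. \<pi> i = i}. x i)"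

definition B_op :: "nat \<Rightarrow> (real \<Rightarrow> real) \<Rightarrow> nat \<Rightarrow> real" where
  "B_op n x i = real n * (LINT t:{(real i - 1) / real n..real i / real n}|lebesgue. x t)"

definition C_op :: "nat \<Rightarrow> (nat \<Rightarrow> real) \<Rightarrow> real \<Rightarrow> real" where
  "C_op n x t = (\<Sum>k=1..n. x k * indicator {(real k - 1) / real n<..<real k / real n} t)"

(* enumerates S_n by {1..n!} for every n *)
definition perm_enumeration :: "(nat \<Rightarrow> nat \<Rightarrow> nat \<Rightarrow> nat) \<Rightarrow> bool" where
  "perm_enumeration e \<longleftrightarrow> (\<forall>n\<ge>1. bij_betw (e n) {1..fact n} {\<pi>. \<pi> permutes {1..n}})"

definition T_op :: "(nat \<Rightarrow> nat \<Rightarrow> nat \<Rightarrow> nat) \<Rightarrow> nat \<Rightarrow> (real \<Rightarrow> real) \<Rightarrow> real \<Rightarrow> real" where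
  "T_op e n x = C_op (fact n) (\<lambda>j. A_op n (B_op n x) (e n j))"

lemma orlicz_function_exp_fun:
  assumes "p \<ge> 1" shows "orlicz_function (exp_fun p)"
proof -
  have "convex_on {0..} (\<lambda>u::real. u powr p)"
  proof (rule convex_onI)
    fix t x y :: real assume t: "0 < t" "t < 1" and xy: "x \<in> {0..}" "y \<in> {0..}"
    have less_one: "(r * z) powr p \<le> r * z powr p" if "0 < r" "r < 1" "z \<ge> 0" for r z :: real
      using that assms powr_mono'[of 1 p r] by (simp add: powr_mult mult_right_mono)
    show "((1 - t) *\<^sub>R x + t *\<^sub>R y) powr p \<le> (1 - t) * x powr p + t * y powr p"
    proof (cases "x = 0 \<or> y = 0")
      case True
      then show ?thesis
        using less_one[of t y] less_one[of "1 - t" x] t xy by auto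
    next
      case False
      then show ?thesis
        using convex_onD[OF powr_convex[OF assms], of t x y] t xy by simp
    qed
  qed simp
  moreover have "mono_on {0..} (exp_fun p)"
    using assms by (auto intro!: mono_onI powr_mono2 simp: exp_fun_def)
  moreover have "convex_on {0..} (\<lambda>u. exp (u powr p) - 1)"
  proof (rule convex_onI)
    fix t x y :: real assume t: "0 < t" "t < 1" and xy: "x \<in> {0..}" "y \<in> {0..}"
    have "((1 - t) *\<^sub>R x + t *\<^sub>R y) powr p \<le> (1 - t) * x powr p + t * y powr p"
      using convex_onD[OF calculation(1), of t x y] t xy by simp
    then have "exp (((1 - t) *\<^sub>R x + t *\<^sub>R y) powr p) \<le> exp ((1 - t) * x powr p + t * y powr p)"
      by simp
    also have "\<dots> \<le> (1 - t) * exp (x powr p) + t * exp (y powr p)"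
      using convex_onD[OF exp_convex, of t "x powr p" "y powr p"] t by simp
    finally show "exp (((1 - t) *\<^sub>R x + t *\<^sub>R y) powr p) - 1
        \<le> (1 - t) * (exp (x powr p) - 1) + t * (exp (y powr p) - 1)"
      by (simp add: algebra_simps)
  qed simp
  ultimately show ?thesis
    by (simp add: orlicz_function_def exp_fun_def[abs_def])
qed

lemma exp_orlicz_function_exists:
  assumes "p > 0" shows "\<exists>N. orlicz_function N \<and> exp_orlicz_function p N"
proof (cases "p \<ge> 1")
  case True
  then show ?thesis
    using orlicz_function_exp_fun by (auto simp: exp_orlicz_function_def)
next
  case False
  define a where "a = ((1 - p) / p) powr (1 / p)"
  have a: "a > 0" "a powr p = (1 - p) / p"
    using assms False by (auto simp: a_def powr_powr)
  define N where "N u = exp ((u + a) powr p) - exp (a powr p)" for u :: real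
  have "mono_on {0..} N"
    using assms a by (auto intro!: mono_onI powr_mono2 simp: N_def)
  moreover have "convex_on {0..} N"
  proof (rule f''_ge0_imp_convex)
    show "convex {0::real..}" by simp
    fix u :: real assume "u \<in> {0..}"
    then have u: "u + a > 0" "u + a \<ge> a" "u \<ge> 0" using a by auto
    let ?v = "u + a"
    have d: "((\<lambda>u. (u + a) powr q) has_real_derivative q * ?v powr (q - 1)) (at u)" for q
      using has_real_derivative_powr[OF u(1), of q] by (simp add: DERIV_shift)
    show "(N has_real_derivative exp (?v powr p) * (p * ?v powr (p - 1))) (at u)"
      unfolding N_def[abs_def] using DERIV_diff[OF DERIV_fun_exp[OF d] DERIV_const] by simp
    have "((\<lambda>u. exp ((u + a) powr p) * (p * (u + a) powr (p - 1))) has_real_derivative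
        exp (?v powr p) * (p * ?v powr (p - 1)) * (p * ?v powr (p - 1))
          + p * ((p - 1) * ?v powr (p - 1 - 1)) * exp (?v powr p)) (at u)"
      by (intro DERIV_mult DERIV_cmult DERIV_fun_exp d)
    also have "exp (?v powr p) * (p * ?v powr (p - 1)) * (p * ?v powr (p - 1))
          + p * ((p - 1) * ?v powr (p - 1 - 1)) * exp (?v powr p)
        = exp (?v powr p) * p * (p * (?v powr (p - 1) * ?v powr (p - 1)) - (1 - p) * ?v powr (p - 2))"
      by (simp add: algebra_simps)
    also have "?v powr (p - 1) * ?v powr (p - 1) = ?v powr (p - 2) * ?v powr p"
      by (simp flip: powr_add)
    also have "exp (?v powr p) * p * (p * (?v powr (p - 2) * ?v powr p) - (1 - p) * ?v powr (p - 2))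
        = exp (?v powr p) * p * ?v powr (p - 2) * (p * ?v powr p - (1 - p))"
      by (simp add: algebra_simps)
    finally show "((\<lambda>u. exp ((u + a) powr p) * (p * (u + a) powr (p - 1))) has_real_derivative
        exp (?v powr p) * p * ?v powr (p - 2) * (p * ?v powr p - (1 - p))) (at u)" .
    have "a powr p \<le> ?v powr p"
      using u a assms by (intro powr_mono2) auto
    then have "p * ?v powr p - (1 - p) \<ge> 0"
      using a assms by (simp add: field_simps)
    then show "exp (?v powr p) * p * ?v powr (p - 2) * (p * ?v powr p - (1 - p)) \<ge> 0"
      using assms by simp
  qed
  moreover have "orlicz_equivalent (exp_fun p) N"
  proof -
    define c where "c = (1/2 :: real) powr p"
    have c: "0 < c" "c < 1"
      using assms powr_less_mono2[of p "1/2" 1] by (auto simp: c_def)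
    define w where "w = (exp (a powr p) / (1 - c)) powr (1 / p)"
    have w: "exp ((1/2 * u) powr p) - 1 \<le> exp (u powr p) - exp (a powr p)" if "u \<ge> w" for u
    proof -
      have "w \<ge> 0"
        by (simp add: w_def)
      have "exp (a powr p) / (1 - c) = w powr p"
        using assms c by (simp add: w_def powr_powr)
      also have "\<dots> \<le> u powr p"
        using that assms \<open>w \<ge> 0\<close> by (intro powr_mono2) auto
      finally have "exp (a powr p) \<le> (1 - c) * u powr p"
        using c by (simp add: field_simps)
      also have "\<dots> \<le> exp ((1 - c) * u powr p) - 1"
        using exp_ge_add_one_self[of "(1 - c) * u powr p"] by linarith
      also have "\<dots> \<le> exp (c * u powr p) * (exp ((1 - c) * u powr p) - 1)"
        using c mult_right_mono[of 1 "exp (c * u powr p)" "exp ((1 - c) * u powr p) - 1"] by simp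
      also have "\<dots> = exp (u powr p) - exp (c * u powr p)"
        by (simp add: right_diff_distrib algebra_simps flip: exp_add)
      also have "c * u powr p = (1/2 * u) powr p"
        using that \<open>w \<ge> 0\<close> by (simp add: c_def powr_mult flip: powr_mult)
      finally show ?thesis
        by linarith
    qed
    have "exp_fun p (1/2 * u) \<le> N u \<and> N u \<le> exp_fun p (2 * u)" if "u \<ge> max w a" for u
    proof
      have "u powr p \<le> (u + a) powr p" "(u + a) powr p \<le> (2 * u) powr p"
        using that a assms by (auto intro!: powr_mono2)
      moreover have "exp (a powr p) \<ge> 1"
        by simp
      ultimately show "exp_fun p (1/2 * u) \<le> N u" "N u \<le> exp_fun p (2 * u)"
        using w[of u] that unfolding exp_fun_def N_def
        by (smt (verit) exp_le_cancel_iff)+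
    qed
    then show ?thesis
      unfolding orlicz_equivalent_def using a
      by (intro exI[of _ "1/2"] exI[of _ 2] conjI exI[of _ "max w a"]) auto
  qed
  ultimately show ?thesis
    using False by (auto simp: exp_orlicz_function_def orlicz_function_def N_def)
qed

end

theory Submission imports Defs "HOL-Real_Asymp.Real_Asymp" begin

text \<open>
For \<open>p > 1\<close> a constant function is already a counterexample. All its averages are equal, so
on the interval of length \<open>1 / n!\<close> belonging to the identity permutation its image under \<open>T_n\<close> is
\<open>n\<close> times as large. The norm of \<open>exp L_p\<close> of a function which is \<open>n\<close> on a set of measure \<open>1 / n!\<close>
is at least \<open>n / (ln (1 + n!)) powr (1/p)\<close>. As \<open>ln (n!)\<close> is of order \<open>n ln n\<close> and \<open>1/p < 1\<close>, these
norms tend to infinity (\<open>exp_orlicz_opnorm_ge\<close>, \<open>filterlim_over_ln_fact\<close>).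

For \<open>p \<le> 1\<close> let \<open>y i\<close> be (half) the absolute value of the \<open>i\<close>-th average of a function \<open>x\<close> of norm at
most one, and let \<open>F \<pi>\<close> be the sum of the \<open>y i\<close> over the fixed points of \<open>\<pi>\<close>, which dominates the
values of \<open>T_n x\<close>. Three facts are combined.

  \<^item> Jensen's inequality bounds the mean of the numbers \<open>N (y i)\<close> by the integral of \<open>N (\<bar>x\<bar> / 2)\<close>,
    that is, by one (\<open>modular_B_op_le\<close>).

  \<^item> Since \<open>p \<le> 1\<close>, the \<open>p\<close>-th power is subadditive (\<open>powr_sum_le\<close>), so \<open>exp (F powr p)\<close> is at most
    the product of the factors \<open>exp (y i powr p)\<close> over the fixed points.

  \<^item> The mean over all permutations of such a product is at most what it would be if the events
    \<open>\<pi> i = i\<close> were independent with weight \<open>e / n\<close> (\<open>sum_exp_fixpoints_le\<close>). It is therefore bounded in terms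
    of the mean of the numbers \<open>exp (y i powr p) - 1\<close> alone, whatever \<open>n\<close> is.

The function \<open>exp (u powr p) - 1\<close> is not convex for \<open>p < 1\<close> and Jensen's inequality is applied to the
convex function \<open>N\<close> instead. The two are exchanged at the price of dilating the argument and adding a
constant (\<open>exp_orlicz_function_bounds\<close>); the additive constant is harmless because the underlying
measure is a probability measure. Finally, convexity turns a bound on the integral of \<open>N\<close> into a
bound on the norm (\<open>orlicz_function_divide_le\<close>).
\<close>

section \<open>Exponential moments of sums over fixed points\<close>

text \<open>Normalising the sum to one, every summand lies in \<open>[0, 1]\<close> and is at most its \<open>p\<close>-th power.\<close>
lemma powr_sum_le:
  fixes f :: "'a \<Rightarrow> real"
  assumes "finite A" "0 < p" "p \<le> 1" "\<And>i. i \<in> A \<Longrightarrow> f i \<ge> 0"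
  shows "(\<Sum>i\<in>A. f i) powr p \<le> (\<Sum>i\<in>A. f i powr p)"
proof (cases "(\<Sum>i\<in>A. f i) = 0")
  case True
  then show ?thesis by (simp add: sum_nonneg)
next
  case False
  define s where "s = (\<Sum>i\<in>A. f i)"
  have s: "s > 0" using False assms(4) by (simp add: s_def sum_nonneg less_le)
  have "f i / s * s powr p \<le> f i powr p" if "i \<in> A" for i
  proof -
    have "f i \<le> s" unfolding s_def by (rule member_le_sum) (use assms that in auto)
    then have "f i / s \<le> (f i / s) powr p"
      using powr_mono'[of p 1 "f i / s"] s assms that by simp
    also have "\<dots> = f i powr p / s powr p" using s assms that by (simp add: powr_divide)
    finally show ?thesis using s by (simp add: field_simps)
  qed
  then have "(\<Sum>i\<in>A. f i / s * s powr p) \<le> (\<Sum>i\<in>A. f i powr p)" by (rule sum_mono)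
  moreover have "(\<Sum>i\<in>A. f i / s * s powr p) = s powr p"
    using s by (simp add: s_def flip: sum_distrib_right sum_divide_distrib)
  ultimately show ?thesis by (simp add: s_def)
qed

text \<open>
The proportion of permutations of \<open>n\<close> points that fix \<open>s\<close> given points is \<open>(n - s)! / n!\<close>; the lemma says
that it is at most \<open>(e / n) ^ s\<close>. It follows from \<open>n! = s! (n choose s) (n - s)!\<close> by bounding the
binomial coefficient below by \<open>(n / s) ^ s\<close> and \<open>s!\<close> below by \<open>(s / e) ^ s\<close>.
\<close>
lemma power_fact_le:
  assumes "s \<le> n"
  shows "real n ^ s * fact (n - s) \<le> exp 1 ^ s * fact n"
proof (cases "s = 0")
  case False
  \<comment> \<open>a single term of the exponential series\<close>
  have "(\<Sum>k\<in>{s}. real s ^ k /\<^sub>R fact k) \<le> exp (real s)"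
    unfolding exp_def by (intro sum_le_suminf summable_exp_generic) auto
  then have "real s ^ s / fact s \<le> exp (real s)"
    by (simp add: divide_inverse_commute)
  then have s: "real s ^ s \<le> exp 1 ^ s * fact s"
    by (simp add: field_simps flip: exp_of_nat_mult)
  have "real n ^ s = (real n / real s) ^ s * real s ^ s"
    using False by (simp add: power_divide)
  also have "\<dots> \<le> real (n choose s) * (exp 1 ^ s * fact s)"
    using binomial_ge_n_over_k_pow_k[OF assms, where 'a=real] s by (intro mult_mono) auto
  finally have "real n ^ s * fact (n - s) \<le> real (n choose s) * (exp 1 ^ s * fact s) * fact (n - s)"
    by (rule mult_right_mono) simp
  also have "\<dots> = exp 1 ^ s * real (fact s * fact (n - s) * (n choose s))" by simp
  also have "\<dots> = exp 1 ^ s * fact n" using binomial_fact_lemma[OF assms] by (simp del: of_nat_mult)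
  finally show ?thesis .
qed simp

text \<open>
With \<open>z i = exp (y i) - 1\<close>, the exponential is the product of the factors \<open>z i + 1\<close> over the fixed points
of \<open>\<pi>\<close>, which expands into a sum over the sets \<open>S\<close> of fixed points. Exchanging the sums leaves,
for each \<open>S\<close>, the number of permutations fixing \<open>S\<close> pointwise, that is, of permutations of the
complement of \<open>S\<close>. After estimating this number, the sum over \<open>S\<close> is folded back into a product.
\<close>
lemma sum_exp_fixpoints_le:
  fixes y :: "nat \<Rightarrow> real"
  assumes "n \<ge> 1" "\<And>i. y i \<ge> 0"
  shows "(\<Sum>\<pi> | \<pi> permutes {1..n}. exp (\<Sum>i\<in>{i\<in>{1..n}. \<pi> i = i}. y i))
    \<le> fact n * exp (exp 1 / real n * (\<Sum>i=1..n. exp (y i) - 1))"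
proof -
  define P where "P = {\<pi>. \<pi> permutes {1..n}}"
  define z where "z i = exp (y i) - 1" for i
  have fP: "finite P" by (simp add: P_def finite_permutations)
  have z: "z i \<ge> 0" for i using assms(2)[of i] by (simp add: z_def)
  have "(\<Sum>\<pi>\<in>P. exp (\<Sum>i\<in>{i\<in>{1..n}. \<pi> i = i}. y i))
      = (\<Sum>\<pi>\<in>P. \<Sum>S\<in>Pow {1..n}. if \<forall>i\<in>S. \<pi> i = i then \<Prod>i\<in>S. z i else 0)"
  proof (rule sum.cong[OF refl])
    fix \<pi>
    let ?F = "{i\<in>{1..n}. \<pi> i = i}"
    have "exp (\<Sum>i\<in>?F. y i) = (\<Prod>i\<in>?F. z i + 1)" by (simp add: exp_sum z_def)
    also have "\<dots> = (\<Sum>S\<in>Pow ?F. \<Prod>i\<in>S. z i)" by (subst prod_add) auto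
    also have "\<dots> = (\<Sum>S\<in>{S\<in>Pow {1..n}. \<forall>i\<in>S. \<pi> i = i}. \<Prod>i\<in>S. z i)"
      by (intro sum.cong) auto
    also have "\<dots> = (\<Sum>S\<in>Pow {1..n}. if \<forall>i\<in>S. \<pi> i = i then \<Prod>i\<in>S. z i else 0)"
      by (rule sum.inter_filter) simp
    finally show "exp (\<Sum>i\<in>?F. y i) = \<dots>" .
  qed
  also have "\<dots> = (\<Sum>S\<in>Pow {1..n}. \<Sum>\<pi>\<in>P. if \<forall>i\<in>S. \<pi> i = i then \<Prod>i\<in>S. z i else 0)"
    by (rule sum.swap)
  also have "\<dots> \<le> (\<Sum>S\<in>Pow {1..n}. fact n * (\<Prod>i\<in>S. exp 1 / real n * z i))"
  proof (rule sum_mono)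
    fix S assume S: "S \<in> Pow {1..n}"
    then have fS: "finite S" and cS: "card S \<le> n"
      using finite_subset[of S "{1..n}"] card_mono[of "{1..n}" S] by auto
    have "{\<pi>\<in>P. \<forall>i\<in>S. \<pi> i = i} = {\<pi>. \<pi> permutes ({1..n} - S)}"
    proof (intro equalityI subsetI)
      fix \<pi> assume "\<pi> \<in> {\<pi>\<in>P. \<forall>i\<in>S. \<pi> i = i}"
      then show "\<pi> \<in> {\<pi>. \<pi> permutes ({1..n} - S)}"
        by (auto simp: P_def intro: permutes_superset)
    next
      fix \<pi> assume \<pi>: "\<pi> \<in> {\<pi>. \<pi> permutes ({1..n} - S)}"
      then show "\<pi> \<in> {\<pi>\<in>P. \<forall>i\<in>S. \<pi> i = i}"
        using permutes_subset[of \<pi> "{1..n} - S" "{1..n}"] permutes_not_in[of \<pi> "{1..n} - S"]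
        by (auto simp: P_def)
    qed
    moreover have "card {\<pi>. \<pi> permutes ({1..n} - S)} = fact (n - card S)"
      using S fS by (intro card_permutations) (auto simp: card_Diff_subset)
    ultimately have "(\<Sum>\<pi>\<in>P. if \<forall>i\<in>S. \<pi> i = i then \<Prod>i\<in>S. z i else 0)
        = fact (n - card S) * (\<Prod>i\<in>S. z i)"
      using fP by (simp flip: sum.inter_filter)
    also have "\<dots> \<le> (exp 1 ^ card S * fact n / real n ^ card S) * (\<Prod>i\<in>S. z i)"
      using power_fact_le[OF cS] assms(1) z
      by (intro mult_right_mono prod_nonneg) (auto simp: field_simps)
    also have "\<dots> = fact n * (\<Prod>i\<in>S. exp 1 / real n * z i)"
      by (simp add: prod.distrib prod_dividef power_divide field_simps)
    finally show "(\<Sum>\<pi>\<in>P. if \<forall>i\<in>S. \<pi> i = i then \<Prod>i\<in>S. z i else 0)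
      \<le> fact n * (\<Prod>i\<in>S. exp 1 / real n * z i)" .
  qed
  also have "\<dots> = fact n * (\<Prod>i=1..n. exp 1 / real n * z i + 1)"
    by (subst prod_add) (auto simp: sum_distrib_left)
  also have "\<dots> \<le> fact n * (\<Prod>i=1..n. exp (exp 1 / real n * z i))"
    using z by (intro mult_left_mono prod_mono)
      (auto simp: add.commute intro!: exp_ge_add_one_self add_nonneg_nonneg)
  also have "\<dots> = fact n * exp (exp 1 / real n * (\<Sum>i=1..n. z i))"
    by (simp add: exp_sum sum_distrib_left)
  finally show ?thesis by (simp add: P_def z_def)
qed

section \<open>Orlicz functions\<close>

text \<open>An Orlicz function is arbitrary on negative arguments, so it is composed with \<open>max 0\<close> to obtain a
monotone, hence Borel, function on the whole line.\<close>
lemma measurable_orlicz_function: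
  assumes "orlicz_function M" "f \<in> borel_measurable \<mu>"
  shows "(\<lambda>t. M \<bar>f t\<bar>) \<in> borel_measurable \<mu>"
proof -
  have "mono (\<lambda>u. M (max 0 u))"
    using assms(1) by (auto simp: orlicz_function_def mono_on_def mono_def)
  then have "(\<lambda>u. M (max 0 u)) \<in> borel_measurable borel"
    by (rule borel_measurable_mono)
  from measurable_compose[OF borel_measurable_abs[OF assms(2)] this] show ?thesis by simp
qed

lemma orlicz_function_nonneg: "orlicz_function M \<Longrightarrow> u \<ge> 0 \<Longrightarrow> M u \<ge> 0"
  unfolding orlicz_function_def mono_on_def by force

lemma orlicz_function_mono: "orlicz_function M \<Longrightarrow> 0 \<le> u \<Longrightarrow> u \<le> v \<Longrightarrow> M u \<le> M v"
  unfolding orlicz_function_def mono_on_def by force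

lemma orlicz_function_divide_le:
  assumes "orlicz_function M" "u \<ge> 0" "c \<ge> 1"
  shows "M (u / c) \<le> M u / c"
  using convex_onD[of "{0..}" M "1/c" 0 u] assms by (simp add: orlicz_function_def)

text \<open>
Jensen's inequality, from a supporting line of \<open>M\<close> at the mean of \<open>\<bar>f\<bar>\<close>. If \<open>f\<close> is not integrable, its
integral is by convention zero and the left-hand side vanishes. The normalisation by the total mass \<open>m\<close>
is there for Lebesgue measure on an interval of length \<open>1 / n\<close>.
\<close>
lemma orlicz_jensen:
  assumes "orlicz_function M" "finite_measure \<mu>" "f \<in> borel_measurable \<mu>"
    and m: "m = measure \<mu> (space \<mu>)" "m > 0"
  shows "ennreal (m * M (\<bar>\<integral>t. f t \<partial>\<mu>\<bar> / m)) \<le> (\<integral>\<^sup>+ t. ennreal (M \<bar>f t\<bar>) \<partial>\<mu>)"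
proof (cases "(\<integral>t. f t \<partial>\<mu>) = 0 \<or> (\<integral>\<^sup>+ t. ennreal (M \<bar>f t\<bar>) \<partial>\<mu>) = \<infinity>")
  case True
  then show ?thesis using assms(1) by (auto simp: orlicz_function_def)
next
  case False
  interpret finite_measure \<mu> by fact
  define y where "y = (\<integral>t. \<bar>f t\<bar> \<partial>\<mu>) / m"
  have f: "integrable \<mu> f"
    using False not_integrable_integral_eq by blast
  have Mf: "integrable \<mu> (\<lambda>t. M \<bar>f t\<bar>)"
    using False assms by (intro integrableI_nonneg measurable_orlicz_function)
      (auto simp: orlicz_function_nonneg less_top)
  have le: "\<bar>\<integral>t. f t \<partial>\<mu>\<bar> / m \<le> y"
    using integral_abs_bound[of \<mu> f] m by (simp add: y_def divide_right_mono)
  moreover have "\<bar>\<integral>t. f t \<partial>\<mu>\<bar> / m > 0" using False m by simp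
  ultimately have y: "y > 0" by linarith
  \<comment> \<open>a supporting line exists only at interior points, whence the separate case of a vanishing integral\<close>
  have conv: "convex_on {0..} M" and yI: "y \<in> interior {0..}"
    using assms(1) y by (simp_all add: orlicz_function_def)
  define c where "c = Inf ((\<lambda>t. (M y - M t) / (y - t)) ` ({y<..} \<inter> {0..}))"
  have c: "M y + c * (u - y) \<le> M u" if "u \<ge> 0" for u
    unfolding c_def by (rule convex_le_Inf_differential[OF conv yI]) (use that in simp)
  have "m * M (\<bar>\<integral>t. f t \<partial>\<mu>\<bar> / m) \<le> m * M y"
    using m(2) by (intro mult_left_mono orlicz_function_mono[OF assms(1) _ le]) simp_all
  also have "\<dots> = m * M y + c * ((\<integral>t. \<bar>f t\<bar> \<partial>\<mu>) - m * y)"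
    using m(2) by (simp add: y_def)
  also have "\<dots> = (\<integral>t. M y + c * (\<bar>f t\<bar> - y) \<partial>\<mu>)"
  proof -
    have "(\<integral>t. M y + c * (\<bar>f t\<bar> - y) \<partial>\<mu>) = (\<integral>t. (M y - c * y) + c * \<bar>f t\<bar> \<partial>\<mu>)"
      by (rule Bochner_Integration.integral_cong) (simp_all add: algebra_simps)
    also have "\<dots> = m * (M y - c * y) + c * (\<integral>t. \<bar>f t\<bar> \<partial>\<mu>)"
      using f m(1) by (subst Bochner_Integration.integral_add) auto
    finally show ?thesis by (simp add: right_diff_distrib)
  qed
  also have "\<dots> \<le> (\<integral>t. M \<bar>f t\<bar> \<partial>\<mu>)"
    using f Mf c by (intro integral_mono) auto
  finally show ?thesis
    using Mf assms(1) by (subst nn_integral_eq_integral) (auto simp: orlicz_function_nonneg ennreal_leI)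
qed

section \<open>Modulars of the operators\<close>
lemma subinterval_subset_unit:
  assumes "i \<in> {1..n}"
  shows "{(real i - 1) / real n..real i / real n} \<subseteq> {0..1}"
  using assms by (auto simp: field_simps)

text \<open>The closed intervals share endpoints; removing the left ones, which are null sets, makes them
disjoint.\<close>
lemma sum_subinterval_integrals_le:
  assumes "n \<ge> 1" "g \<in> borel_measurable (lebesgue_on {0..1})"
  shows "(\<Sum>i=1..n. \<integral>\<^sup>+ t. g t \<partial>lebesgue_on {(real i - 1) / real n..real i / real n})
    \<le> (\<integral>\<^sup>+ t. g t \<partial>lebesgue_on {0..1})"
proof -
  define J where "J i = {(real i - 1) / real n<..real i / real n}" for i
  define h where "h t = g t * indicator {0..1} t" for t
  have h: "h \<in> borel_measurable lebesgue"
    using assms(2) unfolding h_def by (subst (asm) borel_measurable_restrict_space_iff_ennreal) auto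
  have disj: "disjoint_family_on J {1..n}"
  proof -
    have "J i \<inter> J j = {}" if "i < j" for i j
    proof -
      have "real i / real n \<le> (real j - 1) / real n" using that by (intro divide_right_mono) auto
      then show ?thesis by (auto simp: J_def)
    qed
    then have "J i \<inter> J j = {}" if "i \<noteq> j" for i j
      using that by (metis Int_commute linorder_neqE_nat)
    then show ?thesis by (simp add: disjoint_family_on_def)
  qed
  have "(\<integral>\<^sup>+ t. g t \<partial>lebesgue_on {(real i - 1) / real n..real i / real n})
      = (\<integral>\<^sup>+ t. h t * indicator (J i) t \<partial>lebesgue)" if "i \<in> {1..n}" for i
  proof -
    have "AE t in lebesgue. t \<noteq> (real i - 1) / real n"
      by (rule AE_completion) (rule AE_lborel_singleton)
    then have "(\<integral>\<^sup>+ t. g t * indicator {(real i - 1) / real n..real i / real n} t \<partial>lebesgue)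
        = (\<integral>\<^sup>+ t. h t * indicator (J i) t \<partial>lebesgue)"
      using subinterval_subset_unit[OF that]
      by (intro nn_integral_cong_AE) (auto elim!: eventually_mono simp: J_def h_def split: split_indicator)
    then show ?thesis by (simp add: nn_integral_restrict_space)
  qed
  then have "(\<Sum>i=1..n. \<integral>\<^sup>+ t. g t \<partial>lebesgue_on {(real i - 1) / real n..real i / real n})
      = (\<Sum>i=1..n. \<integral>\<^sup>+ t. h t * indicator (J i) t \<partial>lebesgue)" by simp
  also have "\<dots> = (\<integral>\<^sup>+ t. (\<Sum>i=1..n. h t * indicator (J i) t) \<partial>lebesgue)"
    using h by (intro nn_integral_sum[symmetric] borel_measurable_times_ennreal
      borel_measurable_indicator) (simp_all add: J_def)
  also have "\<dots> = (\<integral>\<^sup>+ t. h t * indicator (\<Union>i\<in>{1..n}. J i) t \<partial>lebesgue)"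
    using disj by (simp add: indicator_UN_disjoint flip: sum_distrib_left)
  also have "\<dots> \<le> (\<integral>\<^sup>+ t. h t \<partial>lebesgue)"
    by (intro nn_integral_mono) (auto split: split_indicator)
  also have "\<dots> = (\<integral>\<^sup>+ t. g t \<partial>lebesgue_on {0..1})"
    by (simp add: h_def nn_integral_restrict_space)
  finally show ?thesis .
qed

text \<open>The step function vanishes at the points dividing the intervals, where \<open>M 0 = 0\<close> makes the integrand
vanish too; so the identity of integrands below holds at every point.\<close>
lemma modular_C_op:
  assumes "m \<ge> 1" "M 0 = 0"
  shows "(\<integral>\<^sup>+ t. ennreal (M (\<bar>C_op m y t\<bar> / r)) \<partial>lebesgue_on {0..1})
    = (\<Sum>k=1..m. ennreal (M (\<bar>y k\<bar> / r)) * ennreal (1 / real m))"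
proof -
  define J where "J k = {(real k - 1) / real m<..<real k / real m}" for k
  have sub: "J k \<subseteq> {0..1}" if "k \<in> {1..m}" for k
    using subinterval_subset_unit[OF that] by (auto simp: J_def subset_iff)
  have disj: "k = l" if "t \<in> J k" "t \<in> J l" for k l t
  proof -
    have "\<not> k < l" if "t \<in> J k" "t \<in> J l" for k l
    proof
      assume "k < l"
      then have "real k / real m \<le> (real l - 1) / real m" by (intro divide_right_mono) auto
      then show False using that by (auto simp: J_def)
    qed
    then show ?thesis using that by (metis linorder_neqE_nat)
  qed
  have eq: "ennreal (M (\<bar>C_op m y t\<bar> / r)) = (\<Sum>k=1..m. ennreal (M (\<bar>y k\<bar> / r)) * indicator (J k) t)" for t
  proof (cases "\<exists>l\<in>{1..m}. t \<in> J l")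
    case True
    then obtain l where l: "l \<in> {1..m}" "t \<in> J l" by blast
    have iff: "t \<in> J k \<longleftrightarrow> k = l" for k
      using l disj by blast
    have "C_op m y t = (\<Sum>k=1..m. if k = l then y k else 0)"
      unfolding C_op_def J_def[symmetric] by (intro sum.cong) (auto simp: iff indicator_def)
    also have "\<dots> = y l" using l by simp
    finally have C: "C_op m y t = y l" .
    have "(\<Sum>k=1..m. ennreal (M (\<bar>y k\<bar> / r)) * indicator (J k) t)
        = (\<Sum>k=1..m. if k = l then ennreal (M (\<bar>y k\<bar> / r)) else 0)"
      by (intro sum.cong) (auto simp: iff indicator_def)
    also have "\<dots> = ennreal (M (\<bar>y l\<bar> / r))" using l by simp
    finally show ?thesis by (simp add: C)
  next
    case False
    then have "indicator (J k) t = (0 :: real)" "indicator (J k) t = (0 :: ennreal)" if "k \<in> {1..m}" for k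
      using that by (auto simp: indicator_def)
    then have "C_op m y t = 0" "(\<Sum>k=1..m. ennreal (M (\<bar>y k\<bar> / r)) * indicator (J k) t) = 0"
      unfolding C_op_def J_def[symmetric] by (simp_all add: sum.neutral)
    then show ?thesis
      using assms(2) by simp
  qed
  have "(\<integral>\<^sup>+ t. ennreal (M (\<bar>C_op m y t\<bar> / r)) \<partial>lebesgue_on {0..1})
      = (\<Sum>k=1..m. \<integral>\<^sup>+ t. ennreal (M (\<bar>y k\<bar> / r)) * indicator (J k) t \<partial>lebesgue_on {0..1})"
    unfolding eq by (intro nn_integral_sum measurable_restrict_space1 borel_measurable_times_ennreal
      borel_measurable_indicator) (simp_all add: J_def)
  also have "\<dots> = (\<Sum>k=1..m. ennreal (M (\<bar>y k\<bar> / r)) * ennreal (1 / real m))"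
  proof (rule sum.cong[OF refl])
    fix k assume k: "k \<in> {1..m}"
    have "(\<integral>\<^sup>+ t. ennreal (M (\<bar>y k\<bar> / r)) * indicator (J k) t \<partial>lebesgue_on {0..1})
       = (\<integral>\<^sup>+ t. ennreal (M (\<bar>y k\<bar> / r)) * indicator (J k) t \<partial>lebesgue)"
      using sub[OF k] by (subst nn_integral_restrict_space)
        (auto intro!: nn_integral_cong split: split_indicator)
    also have "\<dots> = ennreal (M (\<bar>y k\<bar> / r)) * emeasure lebesgue (J k)"
      by (rule nn_integral_cmult_indicator) (simp add: J_def)
    also have "emeasure lebesgue (J k) = ennreal (1 / real m)"
      using assms(1) by (simp add: J_def divide_right_mono flip: diff_divide_distrib)
    finally show "(\<integral>\<^sup>+ t. ennreal (M (\<bar>y k\<bar> / r)) * indicator (J k) t \<partial>lebesgue_on {0..1})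
      = ennreal (M (\<bar>y k\<bar> / r)) * ennreal (1 / real m)" .
  qed
  finally show ?thesis .
qed

text \<open>The value is a sum over permutations in which the enumeration has disappeared, which is why the norms
do not depend on its choice.\<close>
lemma modular_T_op:
  assumes "perm_enumeration e" "n \<ge> 1" "M 0 = 0"
  shows "(\<integral>\<^sup>+ t. ennreal (M (\<bar>T_op e n x t\<bar> / r)) \<partial>lebesgue_on {0..1})
    = (\<Sum>\<pi> | \<pi> permutes {1..n}. ennreal (M (\<bar>A_op n (B_op n x) \<pi>\<bar> / r)) * ennreal (1 / fact n))"
proof -
  have "bij_betw (e n) {1..fact n} {\<pi>. \<pi> permutes {1..n}}"
    using assms by (simp add: perm_enumeration_def)
  from sum.reindex_bij_betw[OF this, of "\<lambda>\<pi>. ennreal (M (\<bar>A_op n (B_op n x) \<pi>\<bar> / r)) * ennreal (1 / fact n)"]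
  show ?thesis
    using modular_C_op[of "fact n" M "\<lambda>j. A_op n (B_op n x) (e n j)" r] assms
    by (simp add: T_op_def)
qed

lemma modular_B_op_le:
  assumes "orlicz_function M" "n \<ge> 1" "x \<in> borel_measurable (lebesgue_on {0..1})" "r > 0"
  shows "(\<Sum>i=1..n. ennreal (M (\<bar>B_op n x i\<bar> / r) / real n))
    \<le> (\<integral>\<^sup>+ t. ennreal (M (\<bar>x t\<bar> / r)) \<partial>lebesgue_on {0..1})"
proof -
  define J where "J i = {(real i - 1) / real n..real i / real n}" for i
  have "(\<Sum>i=1..n. ennreal (M (\<bar>B_op n x i\<bar> / r) / real n))
      \<le> (\<Sum>i=1..n. \<integral>\<^sup>+ t. ennreal (M \<bar>x t / r\<bar>) \<partial>lebesgue_on (J i))"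
  proof (rule sum_mono)
    fix i assume i: "i \<in> {1..n}"
    have sub: "J i \<subseteq> {0..1}"
      using subinterval_subset_unit[OF i] by (simp add: J_def)
    have emJ: "emeasure (lebesgue_on (J i)) (space (lebesgue_on (J i))) = ennreal (1 / real n)"
      using assms(2) by (simp add: emeasure_restrict_space space_restrict_space J_def divide_right_mono
        flip: diff_divide_distrib)
    have "x \<in> borel_measurable (lebesgue_on (J i))"
      using assms(3) sub by (auto intro: measurable_restrict_mono)
    then have meas: "(\<lambda>t. x t / r) \<in> borel_measurable (lebesgue_on (J i))" by simp
    have fin: "finite_measure (lebesgue_on (J i))"
      by (rule finite_measureI) (simp only: emJ, simp)
    have B: "\<bar>B_op n x i\<bar> / r = \<bar>\<integral>t. x t / r \<partial>lebesgue_on (J i)\<bar> / (1 / real n)"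
      using assms(4) by (simp add: B_op_def J_def set_lebesgue_integral_def integral_restrict_space abs_mult)
    have "ennreal (1 / real n * M (\<bar>B_op n x i\<bar> / r)) \<le> (\<integral>\<^sup>+ t. ennreal (M \<bar>x t / r\<bar>) \<partial>lebesgue_on (J i))"
      unfolding B using emJ assms(2)
      by (intro orlicz_jensen[OF assms(1) fin meas]) (auto simp: measure_def)
    then show "ennreal (M (\<bar>B_op n x i\<bar> / r) / real n) \<le> (\<integral>\<^sup>+ t. ennreal (M \<bar>x t / r\<bar>) \<partial>lebesgue_on (J i))"
      by simp
  qed
  also have "\<dots> \<le> (\<integral>\<^sup>+ t. ennreal (M \<bar>x t / r\<bar>) \<partial>lebesgue_on {0..1})"
    unfolding J_def using assms
    by (intro sum_subinterval_integrals_le measurable_compose[OF _ measurable_ennreal] measurable_orlicz_function) auto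
  finally show ?thesis using assms(4) by simp
qed

section \<open>Uniform boundedness\<close>

text \<open>
Below the threshold from which the equivalence holds, both functions are bounded, so an additive constant
extends the inequalities to all arguments.
\<close>
lemma exp_orlicz_function_bounds:
  assumes "0 < p" "p \<le> 1" "exp_orlicz_function p N"
  obtains a b K where "orlicz_function N" "a > 0" "b > 0" "K \<ge> 0"
    "\<And>u. u \<ge> 0 \<Longrightarrow> exp ((a * u) powr p) \<le> N u + K" "\<And>u. u \<ge> 0 \<Longrightarrow> N u \<le> exp ((b * u) powr p) + K"
proof -
  have N: "orlicz_function N"
    using assms orlicz_function_exp_fun[of p] by (auto simp: exp_orlicz_function_def split: if_splits)
  have "orlicz_equivalent (exp_fun p) N"
  proof (cases "p = 1")
    case True
    then have "\<forall>u\<ge>0. exp_fun p (1 * u) \<le> N u \<and> N u \<le> exp_fun p (1 * u)"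
      using assms by (simp add: exp_orlicz_function_def)
    then show ?thesis unfolding orlicz_equivalent_def by (meson order_refl zero_less_one)
  qed (use assms in \<open>auto simp: exp_orlicz_function_def split: if_splits\<close>)
  then obtain a b u0 where ab: "a > 0" "b > 0" "u0 \<ge> 0"
    and eq: "\<And>u. u \<ge> u0 \<Longrightarrow> exp_fun p (a * u) \<le> N u \<and> N u \<le> exp_fun p (b * u)"
    unfolding orlicz_equivalent_def by blast
  define K where "K = exp ((a * u0) powr p) + N u0 + 1"
  have Nu0: "N u0 \<ge> 0" using N ab by (simp add: orlicz_function_nonneg)
  have "exp ((a * u) powr p) \<le> N u + K" if "u \<ge> 0" for u
  proof (cases "u \<ge> u0")
    case True
    then have "exp ((a * u) powr p) \<le> N u + 1" using eq[of u] by (simp add: exp_fun_def)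
    then show ?thesis using Nu0 exp_ge_zero[of "(a * u0) powr p"] unfolding K_def by linarith
  next
    case False
    then have "(a * u) powr p \<le> (a * u0) powr p" using that ab assms by (intro powr_mono2) auto
    then have "exp ((a * u) powr p) \<le> exp ((a * u0) powr p)" by simp
    then show ?thesis using Nu0 orlicz_function_nonneg[OF N that] unfolding K_def by linarith
  qed
  note lower = this
  have "N u \<le> exp ((b * u) powr p) + K" if "u \<ge> 0" for u
  proof (cases "u \<ge> u0")
    case True
    then have "N u \<le> exp ((b * u) powr p) - 1" using eq[of u] by (simp add: exp_fun_def)
    then show ?thesis using Nu0 exp_ge_zero[of "(a * u0) powr p"] unfolding K_def by linarith
  next
    case False
    then have "N u \<le> N u0" using that by (intro orlicz_function_mono[OF N]) simp_all
    then show ?thesis using exp_ge_zero[of "(b * u) powr p"] exp_ge_zero[of "(a * u0) powr p"]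
      unfolding K_def by linarith
  qed
  note upper = this
  have "K \<ge> 0" using Nu0 by (simp add: K_def)
  show ?thesis
    by (rule that[OF N ab(1,2) \<open>K \<ge> 0\<close>]) (fact lower upper)+
qed

lemma orlicz_norm_leI:
  assumes "r > 0" "(\<integral>\<^sup>+ t. ennreal (M (\<bar>x t\<bar> / r)) \<partial>lebesgue_on {0..1}) \<le> 1"
  shows "orlicz_norm M x \<le> ennreal r"
  unfolding orlicz_norm_def using assms by (intro Inf_lower) auto

text \<open>The strict inequality spares the question whether the infimum defining the norm is attained.\<close>
lemma modular_le_one:
  assumes "orlicz_function M" "orlicz_norm M x < ennreal r"
  shows "(\<integral>\<^sup>+ t. ennreal (M (\<bar>x t\<bar> / r)) \<partial>lebesgue_on {0..1}) \<le> 1"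
proof -
  obtain s where s: "s > 0" "ennreal s < ennreal r"
    "(\<integral>\<^sup>+ t. ennreal (M (\<bar>x t\<bar> / s)) \<partial>lebesgue_on {0..1}) \<le> 1"
    using assms(2) unfolding orlicz_norm_def Inf_less_iff by blast
  then have "s < r" by (simp add: ennreal_less_iff)
  then have "(\<integral>\<^sup>+ t. ennreal (M (\<bar>x t\<bar> / r)) \<partial>lebesgue_on {0..1})
      \<le> (\<integral>\<^sup>+ t. ennreal (M (\<bar>x t\<bar> / s)) \<partial>lebesgue_on {0..1})"
    using s(1)
    by (intro nn_integral_mono ennreal_leI orlicz_function_mono[OF assms(1)] divide_left_mono) simp_all
  with s(3) show ?thesis by simp
qed

text \<open>
The constant arises as follows. The fact that \<open>orlicz_norm N x \<le> 1\<close> controls the modular of \<open>x / 2\<close>, which costs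
a factor \<open>2\<close>; passing from \<open>N\<close> to the exponential and back costs \<open>b / a\<close>; and the integral of \<open>N\<close> obtained in
this way is at most \<open>L\<close>, so that division by \<open>L\<close> brings it down to one.
\<close>
lemma T_op_uniformly_bounded:
  assumes "0 < p" "p \<le> 1" "exp_orlicz_function p N" "perm_enumeration e"
  obtains C where "\<And>n. n \<ge> 1 \<Longrightarrow> orlicz_opnorm N (T_op e n) \<le> ennreal C"
proof -
  obtain a b K where N: "orlicz_function N" and ab: "a > 0" "b > 0" and K: "K \<ge> 0"
    and lower: "\<And>u. u \<ge> 0 \<Longrightarrow> exp ((a * u) powr p) \<le> N u + K"
    and upper: "\<And>u. u \<ge> 0 \<Longrightarrow> N u \<le> exp ((b * u) powr p) + K"
    using exp_orlicz_function_bounds[OF assms(1-3)] by metis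
  define L where "L = exp (exp 1 * (1 + K)) + K"
  have L: "L \<ge> 1" using K by (simp add: L_def add_increasing2)
  define r where "r = 2 * (b / a) * L"
  have r: "r > 0" using ab L by (simp add: r_def)
  have "orlicz_norm N (T_op e n x) \<le> ennreal r"
    if n: "n \<ge> 1" and x: "x \<in> orlicz_space N" "orlicz_norm N x \<le> 1" for n x
  proof (rule orlicz_norm_leI[OF r])
    define y where "y i = \<bar>B_op n x i\<bar> / 2" for i
    define F where "F \<pi> = (\<Sum>i\<in>{i\<in>{1..n}. \<pi> i = i}. y i)" for \<pi> :: "nat \<Rightarrow> nat"
    define P where "P = {\<pi>. \<pi> permutes {1..n}}"
    have cP: "card P = fact n" unfolding P_def by (rule card_permutations) auto
    have y: "y i \<ge> 0" for i by (simp add: y_def)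
    have Ny: "N (y i) \<ge> 0" for i using N y by (rule orlicz_function_nonneg)
    have F: "F \<pi> \<ge> 0" for \<pi> using y by (simp add: F_def sum_nonneg)
    have "orlicz_norm N x < ennreal 2"
      using x(2) by (rule order.strict_trans1) (simp add: one_less_numeral_iff flip: ennreal_numeral)
    then have "(\<integral>\<^sup>+ t. ennreal (N (\<bar>x t\<bar> / 2)) \<partial>lebesgue_on {0..1}) \<le> 1"
      by (rule modular_le_one[OF N])
    then have "(\<Sum>i=1..n. ennreal (N (y i) / real n)) \<le> 1"
      using modular_B_op_le[OF N n, of x 2] x(1) by (auto simp: orlicz_space_def y_def)
    then have "ennreal (\<Sum>i=1..n. N (y i) / real n) \<le> ennreal 1"
      using Ny by (simp add: sum_ennreal)
    then have avg: "(\<Sum>i=1..n. N (y i)) \<le> real n"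
      using n by (subst (asm) ennreal_le_iff) (auto simp: field_simps simp flip: sum_divide_distrib)
    have "(\<Sum>i=1..n. exp ((a * y i) powr p) - 1) \<le> (\<Sum>i=1..n. N (y i) + K)"
    proof (rule sum_mono)
      fix i show "exp ((a * y i) powr p) - 1 \<le> N (y i) + K" using lower[OF y, of i] by linarith
    qed
    also have "\<dots> \<le> real n * (1 + K)" using avg by (simp add: sum.distrib algebra_simps)
    finally have "exp 1 / real n * (\<Sum>i=1..n. exp ((a * y i) powr p) - 1) \<le> exp 1 / real n * (real n * (1 + K))"
      by (rule mult_left_mono) simp
    also have "\<dots> = exp 1 * (1 + K)" using n by simp
    finally have small: "exp 1 / real n * (\<Sum>i=1..n. exp ((a * y i) powr p) - 1) \<le> exp 1 * (1 + K)" .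
    have "(\<Sum>\<pi>\<in>P. exp (\<Sum>i\<in>{i\<in>{1..n}. \<pi> i = i}. (a * y i) powr p))
        \<le> fact n * exp (exp 1 / real n * (\<Sum>i=1..n. exp ((a * y i) powr p) - 1))"
      unfolding P_def by (rule sum_exp_fixpoints_le) (use n in auto)
    also have "\<dots> \<le> fact n * exp (exp 1 * (1 + K))" using small by simp
    finally have moment: "(\<Sum>\<pi>\<in>P. exp (\<Sum>i\<in>{i\<in>{1..n}. \<pi> i = i}. (a * y i) powr p))
        \<le> fact n * exp (exp 1 * (1 + K))" .
    have point: "N (\<bar>A_op n (B_op n x) \<pi>\<bar> / r)
        \<le> (exp (\<Sum>i\<in>{i\<in>{1..n}. \<pi> i = i}. (a * y i) powr p) + K) / L" for \<pi>
    proof -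
      have "\<bar>A_op n (B_op n x) \<pi>\<bar> \<le> 2 * F \<pi>"
        unfolding A_op_def F_def y_def by (simp add: sum_distrib_left)
      then have "\<bar>A_op n (B_op n x) \<pi>\<bar> / r \<le> 2 * F \<pi> / r"
        using r by (intro divide_right_mono) auto
      also have "2 * F \<pi> / r = (a * F \<pi> / b) / L" using ab L by (simp add: r_def field_simps)
      finally have "N (\<bar>A_op n (B_op n x) \<pi>\<bar> / r) \<le> N ((a * F \<pi> / b) / L)"
        using r by (intro orlicz_function_mono[OF N]) simp_all
      also have "\<dots> \<le> N (a * F \<pi> / b) / L"
        using F ab L by (intro orlicz_function_divide_le[OF N]) simp_all
      also have "\<dots> \<le> (exp ((a * F \<pi>) powr p) + K) / L"
        using upper[of "a * F \<pi> / b"] F[of \<pi>] ab L by (intro divide_right_mono) auto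
      also have "(a * F \<pi>) powr p \<le> (\<Sum>i\<in>{i\<in>{1..n}. \<pi> i = i}. (a * y i) powr p)"
        unfolding F_def sum_distrib_left using assms y ab by (intro powr_sum_le) auto
      finally show ?thesis using L by (simp add: divide_right_mono)
    qed
    have "(\<integral>\<^sup>+ t. ennreal (N (\<bar>T_op e n x t\<bar> / r)) \<partial>lebesgue_on {0..1})
        = (\<Sum>\<pi>\<in>P. ennreal (N (\<bar>A_op n (B_op n x) \<pi>\<bar> / r)) * ennreal (1 / fact n))"
      unfolding P_def using assms(4) n N by (intro modular_T_op) (auto simp: orlicz_function_def)
    also have "\<dots> = ennreal (\<Sum>\<pi>\<in>P. N (\<bar>A_op n (B_op n x) \<pi>\<bar> / r) * (1 / fact n))"
      using orlicz_function_nonneg[OF N] r by (simp add: sum_ennreal flip: ennreal_mult)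
    also have "\<dots> \<le> ennreal 1"
    proof (rule ennreal_leI)
      have "(\<Sum>\<pi>\<in>P. N (\<bar>A_op n (B_op n x) \<pi>\<bar> / r))
          \<le> (\<Sum>\<pi>\<in>P. (exp (\<Sum>i\<in>{i\<in>{1..n}. \<pi> i = i}. (a * y i) powr p) + K) / L)"
        by (rule sum_mono) (rule point)
      also have "\<dots> = ((\<Sum>\<pi>\<in>P. exp (\<Sum>i\<in>{i\<in>{1..n}. \<pi> i = i}. (a * y i) powr p)) + fact n * K) / L"
        by (simp add: sum.distrib cP flip: sum_divide_distrib)
      also have "\<dots> \<le> (fact n * exp (exp 1 * (1 + K)) + fact n * K) / L"
        using moment L by (intro divide_right_mono add_right_mono) auto
      also have "\<dots> = fact n" using L by (simp add: L_def flip: distrib_left)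
      finally show "(\<Sum>\<pi>\<in>P. N (\<bar>A_op n (B_op n x) \<pi>\<bar> / r) * (1 / fact n)) \<le> 1"
        by (simp flip: sum_divide_distrib)
    qed
    finally show "(\<integral>\<^sup>+ t. ennreal (N (\<bar>T_op e n x t\<bar> / r)) \<partial>lebesgue_on {0..1}) \<le> 1" by simp
  qed
  then have "orlicz_opnorm N (T_op e n) \<le> ennreal r" if "n \<ge> 1" for n
    using that unfolding orlicz_opnorm_def by (intro SUP_least) auto
  then show thesis by (rule that)
qed

section \<open>Unboundedness\<close>
lemma B_op_const: "n \<ge> 1 \<Longrightarrow> B_op n (\<lambda>_. c) i = c"
  by (simp add: B_op_def set_lebesgue_integral_def divide_right_mono measure_def flip: diff_divide_distrib)

text \<open>
The constant \<open>ln 2 powr (1 / p)\<close> is the one at which \<open>exp_fun p\<close> equals one, so the constant function \<open>x\<close>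
with this value has norm at most one. The modular of \<open>T_n x\<close> is estimated from below by the single term
belonging to the identity permutation.
\<close>
lemma exp_orlicz_opnorm_ge:
  assumes "p \<ge> 1" "perm_enumeration e" "n \<ge> 1"
  shows "ennreal (ln 2 powr (1 / p) * (real n / ln (1 + fact n) powr (1 / p)))
    \<le> orlicz_opnorm (exp_fun p) (T_op e n)"
proof -
  define c :: real where "c = ln 2 powr (1 / p)"
  define x where "x = (\<lambda>_::real. c)"
  have c: "c > 0" "exp_fun p c = 1"
    using assms(1) by (auto simp: c_def exp_fun_def powr_powr)
  have norm: "orlicz_norm (exp_fun p) x \<le> ennreal 1"
    using c by (intro orlicz_norm_leI) (auto simp: x_def emeasure_restrict_space space_restrict_space)
  then have x: "x \<in> orlicz_space (exp_fun p)"
    by (auto simp: orlicz_space_def x_def intro: order.strict_trans1)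
  have "ennreal (c * (real n / ln (1 + fact n) powr (1 / p))) \<le> orlicz_norm (exp_fun p) (T_op e n x)"
    unfolding orlicz_norm_def
  proof (rule Inf_greatest, clarify)
    fix r :: real assume r: "r > 0"
      and le: "(\<integral>\<^sup>+ t. ennreal (exp_fun p (\<bar>T_op e n x t\<bar> / r)) \<partial>lebesgue_on {0..1}) \<le> 1"
    have A: "A_op n (B_op n x) id = real n * c"
    proof -
      have "{i\<in>{1..n}. id i = i} = {1..n}" by auto
      then show ?thesis using assms(3) by (simp add: A_op_def x_def B_op_const del: mem_Collect_eq)
    qed
    have "ennreal (exp_fun p (real n * c / r)) * ennreal (1 / fact n)
      \<le> (\<Sum>\<pi> | \<pi> permutes {1..n}. ennreal (exp_fun p (\<bar>A_op n (B_op n x) \<pi>\<bar> / r)) * ennreal (1 / fact n))"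
      using member_le_sum[of id "{\<pi>. \<pi> permutes {1..n}}"
        "\<lambda>\<pi>. ennreal (exp_fun p (\<bar>A_op n (B_op n x) \<pi>\<bar> / r)) * ennreal (1 / fact n)"] c
      by (simp add: A finite_permutations permutes_id abs_mult)
    also have "\<dots> \<le> 1"
      using le modular_T_op[OF assms(2,3), of "exp_fun p" x r] by (simp add: exp_fun_def)
    finally have "exp_fun p (real n * c / r) / fact n \<le> 1"
      by (simp add: exp_fun_def flip: ennreal_mult ennreal_1)
    then have "exp ((real n * c / r) powr p) \<le> 1 + fact n"
      by (simp add: exp_fun_def field_simps)
    then have "(real n * c / r) powr p \<le> ln (1 + fact n)"
      by (subst ln_ge_iff) (auto simp: add_pos_pos)
    then have "((real n * c / r) powr p) powr (1 / p) \<le> ln (1 + fact n) powr (1 / p)"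
      using assms(1) by (intro powr_mono2) auto
    then have "real n * c / r \<le> ln (1 + fact n) powr (1 / p)"
      using assms c r by (simp add: powr_powr)
    moreover have "ln (1 + fact n :: real) > 0" by (intro ln_gt_zero) simp
    ultimately show "ennreal (c * (real n / ln (1 + fact n) powr (1 / p))) \<le> ennreal r"
      using r by (intro ennreal_leI) (simp add: field_simps)
  qed
  also have "\<dots> \<le> orlicz_opnorm (exp_fun p) (T_op e n)"
    unfolding orlicz_opnorm_def using x norm by (intro SUP_upper) auto
  finally show ?thesis by (simp add: c_def)
qed

text \<open>The factorial is at most \<open>n ^ n\<close>, so the denominator is at most of order
\<open>(n ln n) powr (1 / p)\<close>, which is smaller than \<open>n\<close> since \<open>p > 1\<close>.\<close>
lemma filterlim_over_ln_fact:
  fixes c p :: real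
  assumes "c > 0" "p > 1"
  shows "filterlim (\<lambda>n. c * (real n / ln (1 + fact n) powr (1 / p))) at_top sequentially"
proof (rule filterlim_at_top_mono)
  show "filterlim (\<lambda>n::nat. c * (real n / ln (1 + real n powr real n) powr (1 / p))) at_top sequentially"
    using assms by real_asymp
  show "eventually (\<lambda>n. c * (real n / ln (1 + real n powr real n) powr (1 / p))
      \<le> c * (real n / ln (1 + fact n) powr (1 / p))) sequentially"
  proof (rule eventually_sequentiallyI[of 1])
    fix n :: nat assume n: "n \<ge> 1"
    have "(fact n :: real) \<le> real n ^ n"
      using fact_le_power[of n, where 'a=real] by simp
    then have "ln (1 + fact n) \<le> ln (1 + real n powr real n)"
      using n by (simp add: powr_realpow add_pos_pos)
    moreover have "ln (1 + fact n :: real) > 0" by (intro ln_gt_zero) simp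
    ultimately show "c * (real n / ln (1 + real n powr real n) powr (1 / p))
      \<le> c * (real n / ln (1 + fact n) powr (1 / p))"
      using assms by (intro mult_left_mono divide_left_mono powr_mono2) auto
  qed
qed

section \<open>The characterization\<close>
theorem corollary13:
  fixes p :: real and N :: "real \<Rightarrow> real" and e :: "nat \<Rightarrow> nat \<Rightarrow> nat \<Rightarrow> nat"
  assumes "p > 0"
    and "exp_orlicz_function p N"
    and "perm_enumeration e"
  shows "(SUP n\<in>{1..}. orlicz_opnorm N (T_op e n)) < \<infinity> \<longleftrightarrow> p \<le> 1"
proof
  assume "p \<le> 1"
  then obtain C where "\<And>n. n \<ge> 1 \<Longrightarrow> orlicz_opnorm N (T_op e n) \<le> ennreal C"
    using T_op_uniformly_bounded assms by metis
  then have "(SUP n\<in>{1..}. orlicz_opnorm N (T_op e n)) \<le> ennreal C"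
    by (intro SUP_least) auto
  then show "(SUP n\<in>{1..}. orlicz_opnorm N (T_op e n)) < \<infinity>"
    by (rule order.strict_trans1) simp
next
  assume fin: "(SUP n\<in>{1..}. orlicz_opnorm N (T_op e n)) < \<infinity>"
  show "p \<le> 1"
  proof (rule ccontr)
    assume "\<not> p \<le> 1"
    then have p: "p > 1" and N: "N = exp_fun p"
      using assms(2) by (auto simp: exp_orlicz_function_def)
    obtain C where C: "C \<ge> 0" "(SUP n\<in>{1..}. orlicz_opnorm N (T_op e n)) = ennreal C"
      using fin by (metis ennreal_cases infinity_ennreal_def less_irrefl)
    define g where "g n = ln 2 powr (1 / p) * (real n / ln (1 + fact n) powr (1 / p))" for n
    have "filterlim g at_top sequentially"
      unfolding g_def by (rule filterlim_over_ln_fact) (use p in auto)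
    then have "eventually (\<lambda>n. g n > C \<and> n \<ge> 1) sequentially"
      by (intro eventually_conj eventually_ge_at_top) (auto simp: filterlim_at_top_dense)
    then obtain n where n: "g n > C" "n \<ge> 1"
      using eventually_happens'[OF sequentially_bot] by blast
    have "ennreal (g n) \<le> orlicz_opnorm N (T_op e n)"
      unfolding g_def N using exp_orlicz_opnorm_ge[of p e n] p assms(3) n by simp
    also have "\<dots> \<le> ennreal C"
      unfolding C(2)[symmetric] using n by (intro SUP_upper) auto
    finally show False using n C by simp
  qed
qed

end
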